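(* Let $a,b\in\mathbb{R}$ and let $G$ be a 3-dimensional real connected Lie group with a global basis of left-invariant vector fields $\{e_0,e_1,e_2\}$ whose commutators are $$[e_0,e_1]=-b\,e_1-a\,e_2,\qquad [e_0,e_2]=a\,e_1-b\,e_2,\qquad [e_1,e_2]=0 .$$ Equip $G$ with the left-invariant almost contact structure $(\varphi,\xi,\eta)$ given by $$\varphi e_0=0,\quad \varphi e_1=e_2,\quad \varphi e_2=-e_1,\quad \xi=e_0,\quad \eta(e_0)=1,\quad \eta(e_1)=\eta(e_2)=0,$$ and the left-invariant B-metric $g$ given by $$g(e_0,e_0)=g(e_1,e_1)=-g(e_2,e_2)=1,\qquad g(e_0,e_1)=g(e_0,e_2)=g(e_1,e_2)=0 .$$ Let $\theta_0=\theta(e_0)$ and $\theta^*_0=\theta^*(e_0)$ be the values of the Lee forms on $e_0$. Then the following hold for $(G,\varphi,\xi,\eta,g)$: (1) The $\varphi$B-connection $\dot D$ (respectively, the $\varphi$-canonical connection $\ddot D$) is zero in the basis $\{e_0,e_1,e_2\}$, i.e. $\dot D_{e_i}e_j=0$ (respectively, $\ddot D_{e_i}e_j=0$) for all $i,j\in\{0,1,2\}$. (2) The manifold is an isotropic-$\mathcal{F}_0$-manifold if and only if $\theta_0=\pm\theta^*_0$. (3) The manifold is flat if and only if it belongs to $\mathcal{F}_0$. (4) The manifold is Ricci-flat (respectively, $*$-Ricci-flat) if and only if it is flat. (5) The manifold is scalar flat if and only if $\theta_0=\pm\sqrt3\,\theta^*_0$. (6) The manifold is $*$-scalar flat if and only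 if it belongs to either $\mathcal{F}_4$ or $\mathcal{F}_5$.
   Context: An almost contact B-metric manifold $(M,\varphi,\xi,\eta,g)$ is a $(2n+1)$-dimensional manifold with a $(1,1)$-tensor field $\varphi$, a vector field $\xi$, a 1-form $\eta$ and a pseudo-Riemannian metric $g$ such that $\varphi\xi=0$, $\varphi^2=-\mathrm{Id}+\eta\otimes\xi$, $\eta\circ\varphi=0$, $\eta(\xi)=1$ and $g(\varphi x,\varphi y)=-g(x,y)+\eta(x)\eta(y)$. Here $\dim G=3$. Let $\nabla$ be the Levi-Civita connection of $g$ and $(g^{ij})$ the inverse of the matrix $(g_{ij})$ of $g$ in a basis $\{e_i\}$. The fundamental tensor is $F(x,y,z)=g\bigl((\nabla_x\varphi)y,z\bigr)$; the Lee forms are $\theta(z)=g^{ij}F(e_i,e_j,z)$ and $\theta^*(z)=g^{ij}F(e_i,\varphi e_j,z)$. Classes. For $x=x^ie_i$, $y=y^ie_i$, $z=z^ie_i$ (indices $0,1,2$) define $$F_4(x,y,z)=\tfrac12\theta_0\bigl\{x^1(y^0z^1+y^1z^0)-x^2(y^0z^2+y^2z^0)\bigr\},$$ $$F_5(x,y,z)=\tfrac12\theta^*_0\bigl\{x^1(y^0z^2+y^2z^0)+x^2(y^0z^1+y^1z^0)\bigr\}.$$ The manifold belongs to $\mathcal{F}_4$ if $F=F_4$, to $\mathcal{F}_5$ if $F=F_5$, and to $\mathcal{F}_0$ if $F=0$. (So $\mathcal{F}_0$ is contained in both $\mathcal{F}_4$ and $\mathcal{F}_5$; "either ... or" is inclusive.)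 The square norm of $\nabla\varphi$ is $\|\nabla\varphi\|^2=g^{ij}g^{ks}g\bigl((\nabla_{e_i}\varphi)e_k,(\nabla_{e_j}\varphi)e_s\bigr)$; the manifold is an isotropic-$\mathcal{F}_0$-manifold if $\|\nabla\varphi\|^2=0$. Curvature. $R(x,y)z=\nabla_x\nabla_yz-\nabla_y\nabla_xz-\nabla_{[x,y]}z$, $R(x,y,z,w)=g(R(x,y)z,w)$, $\rho(x,y)=g^{ij}R(e_i,x,y,e_j)$, $\tau=g^{ij}\rho(e_i,e_j)$, $\rho^*(x,y)=g^{ij}R(e_i,x,y,\varphi e_j)$, $\tau^*=g^{ij}\rho^*(e_i,e_j)$. The manifold is flat if $R=0$, Ricci-flat if $\rho=0$, $*$-Ricci-flat if $\rho^*=0$, scalar flat if $\tau=0$, $*$-scalar flat if $\tau^*=0$. Connections. A linear connection $D$ is natural if $D\varphi=D\xi=D\eta=Dg=0$. The $\varphi$B-connection is the natural connection $$\dot D_xy=\nabla_xy+\tfrac12\bigl\{(\nabla_x\varphi)\varphi y+(\nabla_x\eta)y\cdot\xi\bigr\}-\eta(y)\nabla_x\xi .$$ For a connection $D$ with torsion $T(x,y)=D_xy-D_yx-[x,y]$ put $T(x,y,z)=g(T(x,y),z)$. The $\varphi$-canonical connection $\ddot D$ is the natural connection whose torsion $\ddot T$ satisfies $$\begin{aligned} &\ddot T(x,y,z)-\ddot T(x,z,y)-\ddot T(x,\varphi y,\varphi z)+\ddot T(x,\varphi z,\varphi y)\\ &=\eta(x)\{\ddot T(\xi,y,z)-\ddot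 T(\xi,z,y)-\ddot T(\xi,\varphi y,\varphi z)+\ddot T(\xi,\varphi z,\varphi y)\}\\ &\quad+\eta(y)\{\ddot T(x,\xi,z)-\ddot T(x,z,\xi)-\eta(x)\ddot T(z,\xi,\xi)\}\\ &\quad-\eta(z)\{\ddot T(x,\xi,y)-\ddot T(x,y,\xi)-\eta(x)\ddot T(y,\xi,\xi)\}. \end{aligned}$$ *)

theory Defs
  imports "HOL-Analysis.Analysis" "HOL-Library.Function_Algebras"
begin

text \<open>
  Sums and products of real functions on the manifold, and sums and differences of vector
  fields (operators on functions), are the pointwise ones of \<open>Function_Algebras\<close>.
\<close>

section \<open>Smooth manifolds and Lie groups\<close>

text \<open>Used for open \<open>S\<close> only, so that differentiability at a point of \<open>S\<close> depends on \<open>f\<close> on \<open>S\<close> alone.\<close>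

fun Ck_on :: "nat \<Rightarrow> 'a::euclidean_space set \<Rightarrow> ('a \<Rightarrow> 'b::euclidean_space) \<Rightarrow> bool" where
  "Ck_on 0 S f \<longleftrightarrow> continuous_on S f"
| "Ck_on (Suc k) S f \<longleftrightarrow> (\<forall>x\<in>S. f differentiable (at x)) \<and>
     (\<forall>v. Ck_on k S (\<lambda>x. frechet_derivative f (at x) v))"

definition smooth_on :: "'a::euclidean_space set \<Rightarrow> ('a \<Rightarrow> 'b::euclidean_space) \<Rightarrow> bool" where
  "smooth_on S f \<longleftrightarrow> (\<forall>k. Ck_on k S f)"

text \<open>A chart is a pair of its domain and its coordinate map; its inverse is \<open>inv_into U \<psi>\<close>.\<close>

type_synonym ('m, 'n) atlas = "('m set \<times> ('m \<Rightarrow> real ^ 'n)) set"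

definition smooth_atlas :: "('m::topological_space, 'n::finite) atlas \<Rightarrow> bool" where
  "smooth_atlas A \<longleftrightarrow>
     (\<Union>(U, \<psi>)\<in>A. U) = UNIV \<and>
     (\<forall>(U, \<psi>)\<in>A. open U \<and> open (\<psi> ` U) \<and> homeomorphism U (\<psi> ` U) \<psi> (inv_into U \<psi>)) \<and>
     (\<forall>(U, \<psi>)\<in>A. \<forall>(V, \<zeta>)\<in>A. smooth_on (\<psi> ` (U \<inter> V)) (\<zeta> \<circ> inv_into U \<psi>))"

text \<open>
  Smoothness of the multiplication is expressed in the product charts of the manifold
  \<open>G \<times> G\<close>; by continuity, the sets on which the coordinate expressions are defined are open.
\<close>

definition lie_group ::
  "('g::{t2_space, second_countable_topology}, 'n::finite) atlas
    \<Rightarrow> ('g \<Rightarrow> 'g \<Rightarrow> 'g) \<Rightarrow> 'g \<Rightarrow> ('g \<Rightarrow> 'g) \<Rightarrow> bool" where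
  "lie_group A mul e iv \<longleftrightarrow>
     smooth_atlas A \<and> group mul e iv \<and>
     continuous_on UNIV (\<lambda>(x, y). mul x y) \<and> continuous_on UNIV iv \<and>
     (\<forall>(U, \<psi>)\<in>A. \<forall>(V, \<zeta>)\<in>A. \<forall>(W, \<omega>)\<in>A.
        smooth_on {(u, v). u \<in> \<psi> ` U \<and> v \<in> \<zeta> ` V \<and> mul (inv_into U \<psi> u) (inv_into V \<zeta> v) \<in> W}
          (\<lambda>(u, v). \<omega> (mul (inv_into U \<psi> u) (inv_into V \<zeta> v)))) \<and>
     (\<forall>(U, \<psi>)\<in>A. \<forall>(W, \<omega>)\<in>A.
        smooth_on {u. u \<in> \<psi> ` U \<and> iv (inv_into U \<psi> u) \<in> W} (\<lambda>u. \<omega> (iv (inv_into U \<psi> u))))"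

definition smooth_functions :: "('m::topological_space, 'n::finite) atlas \<Rightarrow> ('m \<Rightarrow> real) set" where
  "smooth_functions A = {f. \<forall>(U, \<psi>)\<in>A. smooth_on (\<psi> ` U) (f \<circ> inv_into U \<psi>)}"


section \<open>Vector fields\<close>

type_synonym 'm vfield = "('m \<Rightarrow> real) \<Rightarrow> ('m \<Rightarrow> real)"

text \<open>
  Vector fields are the derivations of the algebra of smooth functions. They are normalised to
  be \<open>0\<close> on functions that are not smooth, so that equality of vector fields is equality in HOL.
\<close>

definition vector_fields :: "('m::topological_space, 'n::finite) atlas \<Rightarrow> 'm vfield set" where
  "vector_fields A = {X.
     (\<forall>f\<in>smooth_functions A. X f \<in> smooth_functions A) \<and>
     (\<forall>f\<in>smooth_functions A. \<forall>h\<in>smooth_functions A. X (f + h) = X f + X h) \<and>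
     (\<forall>c. \<forall>f\<in>smooth_functions A. X ((\<lambda>_. c) * f) = (\<lambda>_. c) * X f) \<and>
     (\<forall>f\<in>smooth_functions A. \<forall>h\<in>smooth_functions A. X (f * h) = X f * h + f * X h) \<and>
     (\<forall>f. f \<notin> smooth_functions A \<longrightarrow> X f = 0)}"

definition fsmult :: "('m \<Rightarrow> real) \<Rightarrow> 'm vfield \<Rightarrow> 'm vfield" (infixr \<open>\<odot>\<close> 75) where
  "f \<odot> X = (\<lambda>h. f * X h)"

definition lie_bracket :: "'m vfield \<Rightarrow> 'm vfield \<Rightarrow> 'm vfield" where
  "lie_bracket X Y = (\<lambda>f. X (Y f) - Y (X f))"

definition lincomb :: "('n::finite \<Rightarrow> 'm \<Rightarrow> real) \<Rightarrow> ('n \<Rightarrow> 'm vfield) \<Rightarrow> 'm vfield" where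
  "lincomb c e = (\<Sum>i\<in>UNIV. c i \<odot> e i)"

text \<open>A global frame: a basis of the module of vector fields over the ring of smooth functions.\<close>

definition global_basis :: "('m::topological_space, 'n::finite) atlas \<Rightarrow> ('n \<Rightarrow> 'm vfield) \<Rightarrow> bool" where
  "global_basis A e \<longleftrightarrow> (\<forall>i. e i \<in> vector_fields A) \<and>
     (\<forall>X\<in>vector_fields A. \<exists>!c. (\<forall>i. c i \<in> smooth_functions A) \<and> X = lincomb c e)"


section \<open>Tensor fields and left invariance\<close>

definition one_form ::
  "('m::topological_space, 'n::finite) atlas \<Rightarrow> ('m vfield \<Rightarrow> 'm \<Rightarrow> real) \<Rightarrow> bool" where
  "one_form A \<eta> \<longleftrightarrow>
     (\<forall>X\<in>vector_fields A. \<eta> X \<in> smooth_functions A) \<and>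
     (\<forall>X\<in>vector_fields A. \<forall>Y\<in>vector_fields A. \<eta> (X + Y) = \<eta> X + \<eta> Y) \<and>
     (\<forall>f\<in>smooth_functions A. \<forall>X\<in>vector_fields A. \<eta> (f \<odot> X) = f * \<eta> X)"

definition endo_field ::
  "('m::topological_space, 'n::finite) atlas \<Rightarrow> ('m vfield \<Rightarrow> 'm vfield) \<Rightarrow> bool" where
  "endo_field A \<phi> \<longleftrightarrow>
     (\<forall>X\<in>vector_fields A. \<phi> X \<in> vector_fields A) \<and>
     (\<forall>X\<in>vector_fields A. \<forall>Y\<in>vector_fields A. \<phi> (X + Y) = \<phi> X + \<phi> Y) \<and>
     (\<forall>f\<in>smooth_functions A. \<forall>X\<in>vector_fields A. \<phi> (f \<odot> X) = f \<odot> \<phi> X)"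

text \<open>The last conjunct is nondegeneracy on each tangent space; the value of \<open>X\<close> at \<open>p\<close> is
  the tangent vector \<open>f \<mapsto> X f p\<close>.\<close>

definition pseudo_riemannian ::
  "('m::topological_space, 'n::finite) atlas \<Rightarrow> ('m vfield \<Rightarrow> 'm vfield \<Rightarrow> 'm \<Rightarrow> real) \<Rightarrow> bool" where
  "pseudo_riemannian A g \<longleftrightarrow>
     (\<forall>X\<in>vector_fields A. one_form A (g X)) \<and>
     (\<forall>X\<in>vector_fields A. \<forall>Y\<in>vector_fields A. g X Y = g Y X) \<and>
     (\<forall>p. \<forall>X\<in>vector_fields A. (\<forall>Y\<in>vector_fields A. g X Y p = 0) \<longrightarrow> (\<forall>f. X f p = 0))"

definition almost_contact_B_metric ::
  "('m::topological_space, 'n::finite) atlas \<Rightarrow> ('m vfield \<Rightarrow> 'm vfield) \<Rightarrow> 'm vfield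
    \<Rightarrow> ('m vfield \<Rightarrow> 'm \<Rightarrow> real) \<Rightarrow> ('m vfield \<Rightarrow> 'm vfield \<Rightarrow> 'm \<Rightarrow> real) \<Rightarrow> bool" where
  "almost_contact_B_metric A \<phi> \<xi> \<eta> g \<longleftrightarrow>
     odd CARD('n) \<and>
     endo_field A \<phi> \<and> \<xi> \<in> vector_fields A \<and> one_form A \<eta> \<and> pseudo_riemannian A g \<and>
     \<phi> \<xi> = 0 \<and>
     (\<forall>X\<in>vector_fields A. \<phi> (\<phi> X) = - X + \<eta> X \<odot> \<xi>) \<and>
     (\<forall>X\<in>vector_fields A. \<eta> (\<phi> X) = 0) \<and>
     \<eta> \<xi> = 1 \<and>
     (\<forall>X\<in>vector_fields A. \<forall>Y\<in>vector_fields A. g (\<phi> X) (\<phi> Y) = - g X Y + \<eta> X * \<eta> Y)"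

text \<open>The push-forward of a vector field along the left translation \<open>q \<mapsto> mul a q\<close>.\<close>

definition left_push :: "('g \<Rightarrow> 'g \<Rightarrow> 'g) \<Rightarrow> ('g \<Rightarrow> 'g) \<Rightarrow> 'g \<Rightarrow> 'g vfield \<Rightarrow> 'g vfield" where
  "left_push mul iv a X = (\<lambda>f p. X (\<lambda>q. f (mul a q)) (mul (iv a) p))"

definition left_invariant_field ::
  "('g \<Rightarrow> 'g \<Rightarrow> 'g) \<Rightarrow> ('g \<Rightarrow> 'g) \<Rightarrow> 'g vfield \<Rightarrow> bool" where
  "left_invariant_field mul iv X \<longleftrightarrow> (\<forall>a. left_push mul iv a X = X)"

definition left_invariant_structure ::
  "('g::topological_space, 'n::finite) atlas \<Rightarrow> ('g \<Rightarrow> 'g \<Rightarrow> 'g) \<Rightarrow> ('g \<Rightarrow> 'g)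
    \<Rightarrow> ('g vfield \<Rightarrow> 'g vfield) \<Rightarrow> 'g vfield \<Rightarrow> ('g vfield \<Rightarrow> 'g \<Rightarrow> real)
    \<Rightarrow> ('g vfield \<Rightarrow> 'g vfield \<Rightarrow> 'g \<Rightarrow> real) \<Rightarrow> bool" where
  "left_invariant_structure A mul iv \<phi> \<xi> \<eta> g \<longleftrightarrow>
     (\<forall>a. \<forall>X\<in>vector_fields A. \<phi> (left_push mul iv a X) = left_push mul iv a (\<phi> X)) \<and>
     left_invariant_field mul iv \<xi> \<and>
     (\<forall>a p. \<forall>X\<in>vector_fields A. \<eta> (left_push mul iv a X) (mul a p) = \<eta> X p) \<and>
     (\<forall>a p. \<forall>X\<in>vector_fields A. \<forall>Y\<in>vector_fields A.
        g (left_push mul iv a X) (left_push mul iv a Y) (mul a p) = g X Y p)"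


section \<open>Linear connections\<close>

type_synonym 'm connection = "'m vfield \<Rightarrow> 'm vfield \<Rightarrow> 'm vfield"

definition linear_connection :: "('m::topological_space, 'n::finite) atlas \<Rightarrow> 'm connection \<Rightarrow> bool" where
  "linear_connection A D \<longleftrightarrow>
     (\<forall>X\<in>vector_fields A. \<forall>Y\<in>vector_fields A. D X Y \<in> vector_fields A) \<and>
     (\<forall>X\<in>vector_fields A. \<forall>Y\<in>vector_fields A. \<forall>Z\<in>vector_fields A.
        D (X + Y) Z = D X Z + D Y Z \<and> D X (Y + Z) = D X Y + D X Z) \<and>
     (\<forall>f\<in>smooth_functions A. \<forall>X\<in>vector_fields A. \<forall>Y\<in>vector_fields A.
        D (f \<odot> X) Y = f \<odot> D X Y \<and> D X (f \<odot> Y) = X f \<odot> Y + f \<odot> D X Y)"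

definition torsion :: "'m connection \<Rightarrow> 'm vfield \<Rightarrow> 'm vfield \<Rightarrow> 'm vfield" where
  "torsion D X Y = D X Y - D Y X - lie_bracket X Y"

text \<open>Covariant derivatives of a (1,1)-tensor, a 1-form and a (0,2)-tensor.\<close>

definition cov_endo :: "'m connection \<Rightarrow> ('m vfield \<Rightarrow> 'm vfield) \<Rightarrow> 'm vfield \<Rightarrow> 'm vfield \<Rightarrow> 'm vfield" where
  "cov_endo D \<phi> X Y = D X (\<phi> Y) - \<phi> (D X Y)"

definition cov_form :: "'m connection \<Rightarrow> ('m vfield \<Rightarrow> 'm \<Rightarrow> real) \<Rightarrow> 'm vfield \<Rightarrow> 'm vfield \<Rightarrow> 'm \<Rightarrow> real" where
  "cov_form D \<eta> X Y = X (\<eta> Y) - \<eta> (D X Y)"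

definition cov_bilinear ::
  "'m connection \<Rightarrow> ('m vfield \<Rightarrow> 'm vfield \<Rightarrow> 'm \<Rightarrow> real)
    \<Rightarrow> 'm vfield \<Rightarrow> 'm vfield \<Rightarrow> 'm vfield \<Rightarrow> 'm \<Rightarrow> real" where
  "cov_bilinear D g X Y Z = X (g Y Z) - g (D X Y) Z - g Y (D X Z)"

definition levi_civita ::
  "('m::topological_space, 'n::finite) atlas \<Rightarrow> ('m vfield \<Rightarrow> 'm vfield \<Rightarrow> 'm \<Rightarrow> real)
    \<Rightarrow> 'm connection \<Rightarrow> bool" where
  "levi_civita A g D \<longleftrightarrow> linear_connection A D \<and>
     (\<forall>X\<in>vector_fields A. \<forall>Y\<in>vector_fields A. torsion D X Y = 0) \<and>
     (\<forall>X\<in>vector_fields A. \<forall>Y\<in>vector_fields A. \<forall>Z\<in>vector_fields A. cov_bilinear D g X Y Z = 0)"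

definition natural_connection ::
  "('m::topological_space, 'n::finite) atlas \<Rightarrow> ('m vfield \<Rightarrow> 'm vfield) \<Rightarrow> 'm vfield
    \<Rightarrow> ('m vfield \<Rightarrow> 'm \<Rightarrow> real) \<Rightarrow> ('m vfield \<Rightarrow> 'm vfield \<Rightarrow> 'm \<Rightarrow> real)
    \<Rightarrow> 'm connection \<Rightarrow> bool" where
  "natural_connection A \<phi> \<xi> \<eta> g D \<longleftrightarrow> linear_connection A D \<and>
     (\<forall>X\<in>vector_fields A. \<forall>Y\<in>vector_fields A. cov_endo D \<phi> X Y = 0) \<and>
     (\<forall>X\<in>vector_fields A. D X \<xi> = 0) \<and>
     (\<forall>X\<in>vector_fields A. \<forall>Y\<in>vector_fields A. cov_form D \<eta> X Y = 0) \<and>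
     (\<forall>X\<in>vector_fields A. \<forall>Y\<in>vector_fields A. \<forall>Z\<in>vector_fields A. cov_bilinear D g X Y Z = 0)"

definition phiB_connection ::
  "('m vfield \<Rightarrow> 'm vfield) \<Rightarrow> 'm vfield \<Rightarrow> ('m vfield \<Rightarrow> 'm \<Rightarrow> real) \<Rightarrow> 'm connection \<Rightarrow> 'm connection" where
  "phiB_connection \<phi> \<xi> \<eta> nabla X Y =
     nabla X Y + (\<lambda>_. 1/2) \<odot> (cov_endo nabla \<phi> X (\<phi> Y) + cov_form nabla \<eta> X Y \<odot> \<xi>)
       - \<eta> Y \<odot> nabla X \<xi>"

definition phi_canonical_connection ::
  "('m::topological_space, 'n::finite) atlas \<Rightarrow> ('m vfield \<Rightarrow> 'm vfield) \<Rightarrow> 'm vfield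
    \<Rightarrow> ('m vfield \<Rightarrow> 'm \<Rightarrow> real) \<Rightarrow> ('m vfield \<Rightarrow> 'm vfield \<Rightarrow> 'm \<Rightarrow> real)
    \<Rightarrow> 'm connection \<Rightarrow> bool" where
  "phi_canonical_connection A \<phi> \<xi> \<eta> g D \<longleftrightarrow> natural_connection A \<phi> \<xi> \<eta> g D \<and>
     (let T = (\<lambda>x y z. g (torsion D x y) z) in
      \<forall>x\<in>vector_fields A. \<forall>y\<in>vector_fields A. \<forall>z\<in>vector_fields A.
        T x y z - T x z y - T x (\<phi> y) (\<phi> z) + T x (\<phi> z) (\<phi> y) =
          \<eta> x * (T \<xi> y z - T \<xi> z y - T \<xi> (\<phi> y) (\<phi> z) + T \<xi> (\<phi> z) (\<phi> y))
          + \<eta> y * (T x \<xi> z - T x z \<xi> - \<eta> x * T z \<xi> \<xi>)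
          - \<eta> z * (T x \<xi> y - T x y \<xi> - \<eta> x * T y \<xi> \<xi>))"


section \<open>Contractions, the fundamental tensor and the basic classes\<close>

definition metric_inv ::
  "('m vfield \<Rightarrow> 'm vfield \<Rightarrow> 'm \<Rightarrow> real) \<Rightarrow> ('n::finite \<Rightarrow> 'm vfield) \<Rightarrow> 'n \<Rightarrow> 'n \<Rightarrow> 'm \<Rightarrow> real" where
  "metric_inv g e i j = (\<lambda>p. matrix_inv (\<chi> k l. g (e k) (e l) p) $ i $ j)"

text \<open>The contraction \<open>g\<^sup>i\<^sup>j B(e\<^sub>i, e\<^sub>j)\<close>.\<close>

definition metric_trace ::
  "('m vfield \<Rightarrow> 'm vfield \<Rightarrow> 'm \<Rightarrow> real) \<Rightarrow> ('n::finite \<Rightarrow> 'm vfield)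
    \<Rightarrow> ('m vfield \<Rightarrow> 'm vfield \<Rightarrow> 'm \<Rightarrow> real) \<Rightarrow> 'm \<Rightarrow> real" where
  "metric_trace g e B = (\<Sum>i\<in>UNIV. \<Sum>j\<in>UNIV. metric_inv g e i j * B (e i) (e j))"

definition fundamental_tensor ::
  "('m vfield \<Rightarrow> 'm vfield \<Rightarrow> 'm \<Rightarrow> real) \<Rightarrow> 'm connection \<Rightarrow> ('m vfield \<Rightarrow> 'm vfield)
    \<Rightarrow> 'm vfield \<Rightarrow> 'm vfield \<Rightarrow> 'm vfield \<Rightarrow> 'm \<Rightarrow> real" where
  "fundamental_tensor g nabla \<phi> x y z = g (cov_endo nabla \<phi> x y) z"

definition lee_form ::
  "('m vfield \<Rightarrow> 'm vfield \<Rightarrow> 'm \<Rightarrow> real) \<Rightarrow> 'm connection \<Rightarrow> ('m vfield \<Rightarrow> 'm vfield)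
    \<Rightarrow> ('n::finite \<Rightarrow> 'm vfield) \<Rightarrow> 'm vfield \<Rightarrow> 'm \<Rightarrow> real" where
  "lee_form g nabla \<phi> e z = metric_trace g e (\<lambda>x y. fundamental_tensor g nabla \<phi> x y z)"

definition lee_form_star ::
  "('m vfield \<Rightarrow> 'm vfield \<Rightarrow> 'm \<Rightarrow> real) \<Rightarrow> 'm connection \<Rightarrow> ('m vfield \<Rightarrow> 'm vfield)
    \<Rightarrow> ('n::finite \<Rightarrow> 'm vfield) \<Rightarrow> 'm vfield \<Rightarrow> 'm \<Rightarrow> real" where
  "lee_form_star g nabla \<phi> e z = metric_trace g e (\<lambda>x y. fundamental_tensor g nabla \<phi> x (\<phi> y) z)"

definition class_F0 ::
  "('m::topological_space, 'n::finite) atlas \<Rightarrow> ('m vfield \<Rightarrow> 'm vfield)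
    \<Rightarrow> ('m vfield \<Rightarrow> 'm vfield \<Rightarrow> 'm \<Rightarrow> real) \<Rightarrow> 'm connection \<Rightarrow> bool" where
  "class_F0 A \<phi> g nabla \<longleftrightarrow>
     (\<forall>x\<in>vector_fields A. \<forall>y\<in>vector_fields A. \<forall>z\<in>vector_fields A.
        fundamental_tensor g nabla \<phi> x y z = 0)"

text \<open>Below \<open>x\<close>, \<open>y\<close>, \<open>z\<close> are the families of component functions, indexed by the type \<open>3\<close>
  with elements \<open>0\<close>, \<open>1\<close>, \<open>2\<close>.\<close>

definition class_F4 ::
  "('m::topological_space, 3) atlas \<Rightarrow> ('m vfield \<Rightarrow> 'm vfield)
    \<Rightarrow> ('m vfield \<Rightarrow> 'm vfield \<Rightarrow> 'm \<Rightarrow> real) \<Rightarrow> 'm connection \<Rightarrow> (3 \<Rightarrow> 'm vfield) \<Rightarrow> bool" where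
  "class_F4 A \<phi> g nabla e \<longleftrightarrow>
     (\<forall>x y z. (\<forall>i. x i \<in> smooth_functions A \<and> y i \<in> smooth_functions A \<and> z i \<in> smooth_functions A) \<longrightarrow>
        fundamental_tensor g nabla \<phi> (lincomb x e) (lincomb y e) (lincomb z e) =
          (\<lambda>_. 1/2) * lee_form g nabla \<phi> e (e 0) *
            (x 1 * (y 0 * z 1 + y 1 * z 0) - x 2 * (y 0 * z 2 + y 2 * z 0)))"

definition class_F5 ::
  "('m::topological_space, 3) atlas \<Rightarrow> ('m vfield \<Rightarrow> 'm vfield)
    \<Rightarrow> ('m vfield \<Rightarrow> 'm vfield \<Rightarrow> 'm \<Rightarrow> real) \<Rightarrow> 'm connection \<Rightarrow> (3 \<Rightarrow> 'm vfield) \<Rightarrow> bool" where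
  "class_F5 A \<phi> g nabla e \<longleftrightarrow>
     (\<forall>x y z. (\<forall>i. x i \<in> smooth_functions A \<and> y i \<in> smooth_functions A \<and> z i \<in> smooth_functions A) \<longrightarrow>
        fundamental_tensor g nabla \<phi> (lincomb x e) (lincomb y e) (lincomb z e) =
          (\<lambda>_. 1/2) * lee_form_star g nabla \<phi> e (e 0) *
            (x 1 * (y 0 * z 2 + y 2 * z 0) + x 2 * (y 0 * z 1 + y 1 * z 0)))"

definition sqnorm_nabla_phi ::
  "('m vfield \<Rightarrow> 'm vfield \<Rightarrow> 'm \<Rightarrow> real) \<Rightarrow> 'm connection \<Rightarrow> ('m vfield \<Rightarrow> 'm vfield)
    \<Rightarrow> ('n::finite \<Rightarrow> 'm vfield) \<Rightarrow> 'm \<Rightarrow> real" where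
  "sqnorm_nabla_phi g nabla \<phi> e =
     (\<Sum>i\<in>UNIV. \<Sum>j\<in>UNIV. \<Sum>k\<in>UNIV. \<Sum>s\<in>UNIV. metric_inv g e i j * metric_inv g e k s *
        g (cov_endo nabla \<phi> (e i) (e k)) (cov_endo nabla \<phi> (e j) (e s)))"

definition isotropic_F0 ::
  "('m vfield \<Rightarrow> 'm vfield \<Rightarrow> 'm \<Rightarrow> real) \<Rightarrow> 'm connection \<Rightarrow> ('m vfield \<Rightarrow> 'm vfield)
    \<Rightarrow> ('n::finite \<Rightarrow> 'm vfield) \<Rightarrow> bool" where
  "isotropic_F0 g nabla \<phi> e \<longleftrightarrow> sqnorm_nabla_phi g nabla \<phi> e = 0"


section \<open>Curvature\<close>

definition curvature :: "'m connection \<Rightarrow> 'm vfield \<Rightarrow> 'm vfield \<Rightarrow> 'm vfield \<Rightarrow> 'm vfield" where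
  "curvature nabla x y z = nabla x (nabla y z) - nabla y (nabla x z) - nabla (lie_bracket x y) z"

definition ricci ::
  "('m vfield \<Rightarrow> 'm vfield \<Rightarrow> 'm \<Rightarrow> real) \<Rightarrow> 'm connection \<Rightarrow> ('n::finite \<Rightarrow> 'm vfield)
    \<Rightarrow> 'm vfield \<Rightarrow> 'm vfield \<Rightarrow> 'm \<Rightarrow> real" where
  "ricci g nabla e x y = metric_trace g e (\<lambda>u w. g (curvature nabla u x y) w)"

definition ricci_star ::
  "('m vfield \<Rightarrow> 'm vfield \<Rightarrow> 'm \<Rightarrow> real) \<Rightarrow> 'm connection \<Rightarrow> ('m vfield \<Rightarrow> 'm vfield)
    \<Rightarrow> ('n::finite \<Rightarrow> 'm vfield) \<Rightarrow> 'm vfield \<Rightarrow> 'm vfield \<Rightarrow> 'm \<Rightarrow> real" where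
  "ricci_star g nabla \<phi> e x y = metric_trace g e (\<lambda>u w. g (curvature nabla u x y) (\<phi> w))"

definition scalar_curvature ::
  "('m vfield \<Rightarrow> 'm vfield \<Rightarrow> 'm \<Rightarrow> real) \<Rightarrow> 'm connection \<Rightarrow> ('n::finite \<Rightarrow> 'm vfield) \<Rightarrow> 'm \<Rightarrow> real" where
  "scalar_curvature g nabla e = metric_trace g e (ricci g nabla e)"

definition scalar_curvature_star ::
  "('m vfield \<Rightarrow> 'm vfield \<Rightarrow> 'm \<Rightarrow> real) \<Rightarrow> 'm connection \<Rightarrow> ('m vfield \<Rightarrow> 'm vfield)
    \<Rightarrow> ('n::finite \<Rightarrow> 'm vfield) \<Rightarrow> 'm \<Rightarrow> real" where
  "scalar_curvature_star g nabla \<phi> e = metric_trace g e (ricci_star g nabla \<phi> e)"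

definition flat :: "('m::topological_space, 'n::finite) atlas \<Rightarrow> 'm connection \<Rightarrow> bool" where
  "flat A nabla \<longleftrightarrow>
     (\<forall>x\<in>vector_fields A. \<forall>y\<in>vector_fields A. \<forall>z\<in>vector_fields A. curvature nabla x y z = 0)"

definition ricci_flat ::
  "('m::topological_space, 'n::finite) atlas \<Rightarrow> ('m vfield \<Rightarrow> 'm vfield \<Rightarrow> 'm \<Rightarrow> real)
    \<Rightarrow> 'm connection \<Rightarrow> ('n \<Rightarrow> 'm vfield) \<Rightarrow> bool" where
  "ricci_flat A g nabla e \<longleftrightarrow>
     (\<forall>x\<in>vector_fields A. \<forall>y\<in>vector_fields A. ricci g nabla e x y = 0)"

definition star_ricci_flat ::
  "('m::topological_space, 'n::finite) atlas \<Rightarrow> ('m vfield \<Rightarrow> 'm vfield)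
    \<Rightarrow> ('m vfield \<Rightarrow> 'm vfield \<Rightarrow> 'm \<Rightarrow> real) \<Rightarrow> 'm connection \<Rightarrow> ('n \<Rightarrow> 'm vfield) \<Rightarrow> bool" where
  "star_ricci_flat A \<phi> g nabla e \<longleftrightarrow>
     (\<forall>x\<in>vector_fields A. \<forall>y\<in>vector_fields A. ricci_star g nabla \<phi> e x y = 0)"

end

theory Submission
  imports Defs
begin

text \<open>
  In a frame with constant structure functions and constant metric coefficients, the whole
  geometry is linear algebra over the constants: the Koszul formula makes the Levi-Civita
  connection map combinations of \<open>e 0\<close>, \<open>e 1\<close>, \<open>e 2\<close> with constant coefficients to such combinations
  (\<open>nabla_const_comb\<close>). From \<open>[e\<^sub>0, e\<^sub>1]\<close> and \<open>[e\<^sub>0, e\<^sub>2]\<close> one finds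
  \<open>\<nabla>\<^bsub>e\<^sub>0\<^esub> = 0\<close> on the frame, \<open>\<nabla>\<^bsub>e\<^sub>1\<^esub> e\<^sub>0 = b e\<^sub>1 + a e\<^sub>2\<close>, \<open>\<nabla>\<^bsub>e\<^sub>2\<^esub> e\<^sub>0 = - a e\<^sub>1 + b e\<^sub>2\<close>,
  and multiples of \<open>e\<^sub>0\<close> for the remaining derivatives.

  Every invariant in the proposition is then a polynomial in \<open>a\<close> and \<open>b\<close>. The Lee forms give
  \<open>\<theta>\<^sub>0 = 2 a\<close> and \<open>\<theta>\<^sup>*\<^sub>0 = 2 b\<close>, and \<open>F = F\<^sub>4 + F\<^sub>5\<close> with \<open>F\<^sub>4\<close> proportional to \<open>a\<close> and \<open>F\<^sub>5\<close>
  proportional to \<open>b\<close> (\<open>fundamental_tensor_lincomb\<close>), so the three classes are given by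
  \<open>b = 0\<close>, by \<open>a = 0\<close> and by both. The square norm of \<open>\<nabla>\<phi>\<close> is
  \<open>4 (a\<^sup>2 - b\<^sup>2)\<close>, the scalar curvatures are \<open>\<tau> = 2 (a\<^sup>2 - 3 b\<^sup>2)\<close> and \<open>\<tau>\<^sup>* = 4 a b\<close>, which yields
  the isotropy, scalar flatness and \<open>*\<close>-scalar flatness criteria.

  Each of flatness, Ricci flatness and \<open>*\<close>-Ricci flatness forces \<open>a = b = 0\<close>, because suitable
  components of the tensor vanish only then. Conversely, if \<open>a = b = 0\<close>, the frame is parallel
  and \<open>\<nabla>\<close> is flat (\<open>flat_if_parallel\<close>).

  A connection that preserves \<open>\<phi>\<close>, \<open>e\<^sub>0\<close>, \<open>\<eta>\<close> and \<open>g\<close> vanishes on the frame: \<open>D\<^sub>X e\<^sub>1\<close> is orthogonal to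
  \<open>e\<^sub>0\<close> by \<open>D\<eta> = 0\<close> and to \<open>e\<^sub>1\<close> because \<open>e\<^sub>1\<close> has constant length, while \<open>\<phi>\<close> makes the
  two terms of the derivative of \<open>g(e\<^sub>1, e\<^sub>2)\<close> equal, so it is orthogonal to \<open>e\<^sub>2\<close> as well
  (\<open>natural_connection_e\<close>). For the \<open>\<phi>\<close>B-connection the values are computed.
\<close>


section \<open>Smooth functions\<close>

text \<open>
  The condition \<open>open S\<close> makes a derivative at a point of \<open>S\<close> depend on the values on \<open>S\<close> only,
  so the Leibniz and sum rules, which hold on \<open>S\<close>, can be substituted inside \<^const>\<open>Ck_on\<close>.
\<close>

lemma Ck_on_cong:
  assumes "open S" and "\<And>x. x \<in> S \<Longrightarrow> f x = h x" and "Ck_on k S f"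
  shows "Ck_on k S h"
  using assms(2,3)
proof (induction k arbitrary: f h)
  case 0
  then show ?case using continuous_on_cong by (metis Ck_on.simps(1))
next
  case (Suc k)
  have d: "h differentiable (at x)" if "x \<in> S" for x
  proof -
    have "(f has_derivative frechet_derivative f (at x)) (at x)"
      using Suc.prems that frechet_derivative_works by auto
    then show ?thesis
      using has_derivative_transform_within_open[OF _ assms(1) that] Suc.prems(1)
      unfolding differentiable_def by blast
  qed
  have eq: "frechet_derivative f (at x) = frechet_derivative h (at x)" if "x \<in> S" for x
    using frechet_derivative_transform_within_open[of f x S h] Suc.prems assms(1) that by auto
  have "Ck_on k S (\<lambda>x. frechet_derivative h (at x) v)" for v
  proof (rule Suc.IH)
    show "Ck_on k S (\<lambda>x. frechet_derivative f (at x) v)" using Suc.prems by simp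
  qed (simp add: eq)
  with d show ?case by simp
qed

lemma Ck_on_const: "Ck_on k S (\<lambda>_. c)"
proof (induction k arbitrary: c)
  case (Suc k)
  then show ?case by simp
qed simp

text \<open>
  The Leibniz rule for the derivative of a \<open>C\<^sup>k\<^sup>+\<^sup>1\<close> product involves the factors themselves, to
  which the induction hypothesis for \<open>k\<close> must apply.
\<close>

lemma Ck_on_SucD: "Ck_on (Suc k) S f \<Longrightarrow> Ck_on k S f"
proof (induction k arbitrary: f)
  case 0
  then show ?case
    by (auto intro!: continuous_at_imp_continuous_on differentiable_imp_continuous_within)
qed auto

lemma Ck_on_add:
  assumes "open S" and "Ck_on k S f" and "Ck_on k S h"
  shows "Ck_on k S (\<lambda>x. f x + h x)"
  using assms(2,3)
proof (induction k arbitrary: f h)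
  case (Suc k)
  have eq: "frechet_derivative (\<lambda>x. f x + h x) (at x) v
      = frechet_derivative f (at x) v + frechet_derivative h (at x) v" if "x \<in> S" for x v
  proof -
    have "((\<lambda>x. f x + h x) has_derivative
        (\<lambda>v. frechet_derivative f (at x) v + frechet_derivative h (at x) v)) (at x)"
      using Suc.prems that by (intro has_derivative_add) (auto simp: frechet_derivative_works)
    from frechet_derivative_at[OF this, symmetric] show ?thesis by simp
  qed
  have "Ck_on k S (\<lambda>x. frechet_derivative (\<lambda>x. f x + h x) (at x) v)" for v
  proof (rule Ck_on_cong[OF assms(1)])
    show "Ck_on k S (\<lambda>x. frechet_derivative f (at x) v + frechet_derivative h (at x) v)"
      using Suc by simp
  qed (simp add: eq)
  then show ?case using Suc.prems by simp
qed (auto intro: continuous_intros)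

lemma Ck_on_mult:
  fixes f h :: "'a::euclidean_space \<Rightarrow> real"
  assumes "open S" and "Ck_on k S f" and "Ck_on k S h"
  shows "Ck_on k S (\<lambda>x. f x * h x)"
  using assms(2,3)
proof (induction k arbitrary: f h)
  case (Suc k)
  have eq: "frechet_derivative (\<lambda>x. f x * h x) (at x) v
      = f x * frechet_derivative h (at x) v + frechet_derivative f (at x) v * h x"
    if "x \<in> S" for x v
  proof -
    have "((\<lambda>x. f x * h x) has_derivative
        (\<lambda>v. f x * frechet_derivative h (at x) v + frechet_derivative f (at x) v * h x)) (at x)"
      using Suc.prems that by (intro has_derivative_mult) (auto simp: frechet_derivative_works)
    from frechet_derivative_at[OF this, symmetric] show ?thesis by simp
  qed
  have "Ck_on k S (\<lambda>x. frechet_derivative (\<lambda>x. f x * h x) (at x) v)" for v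
  proof (rule Ck_on_cong[OF assms(1)])
    show "Ck_on k S (\<lambda>x. f x * frechet_derivative h (at x) v
        + frechet_derivative f (at x) v * h x)"
      using Suc.prems Suc.prems[THEN Ck_on_SucD]
      by (intro Ck_on_add[OF assms(1)] Suc.IH) simp_all
  qed (simp add: eq)
  then show ?case using Suc.prems by (auto intro: derivative_intros)
qed (auto intro: continuous_intros)

lemma smooth_functions_const [simp]: "(\<lambda>_. c) \<in> smooth_functions A"
  by (auto simp: smooth_functions_def smooth_on_def comp_def Ck_on_const)

lemma smooth_functions_0 [simp]: "0 \<in> smooth_functions A"
  using smooth_functions_const[of 0] by (simp add: zero_fun_def)


section \<open>The module of vector fields\<close>

locale smooth_manifold =
  fixes A :: "('m::topological_space, 'n::finite) atlas"
  assumes smooth_atlas: "smooth_atlas A"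
begin

abbreviation "\<F> \<equiv> smooth_functions A"
abbreviation "\<X> \<equiv> vector_fields A"

lemma open_chart_image: "(U, \<psi>) \<in> A \<Longrightarrow> open (\<psi> ` U)"
  using smooth_atlas unfolding smooth_atlas_def by blast

lemma smooth_add [simp, intro]: "f \<in> \<F> \<Longrightarrow> h \<in> \<F> \<Longrightarrow> f + h \<in> \<F>"
  unfolding smooth_functions_def smooth_on_def comp_def
  by (auto intro!: Ck_on_add open_chart_image)

lemma smooth_mult [simp, intro]: "f \<in> \<F> \<Longrightarrow> h \<in> \<F> \<Longrightarrow> f * h \<in> \<F>"
  unfolding smooth_functions_def smooth_on_def comp_def
  by (auto intro!: Ck_on_mult open_chart_image)

lemma smooth_uminus [simp, intro]: "f \<in> \<F> \<Longrightarrow> - f \<in> \<F>"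
  using smooth_mult[of "\<lambda>_. - 1" f] by (simp add: times_fun_def fun_Compl_def)

lemma smooth_diff [simp, intro]: "f \<in> \<F> \<Longrightarrow> h \<in> \<F> \<Longrightarrow> f - h \<in> \<F>"
  using smooth_add[of f "- h"] by simp

lemma vf_smooth [simp, intro]: "X \<in> \<X> \<Longrightarrow> X f \<in> \<F>"
  unfolding vector_fields_def by (cases "f \<in> \<F>") auto

lemma vf_add: "X \<in> \<X> \<Longrightarrow> f \<in> \<F> \<Longrightarrow> h \<in> \<F> \<Longrightarrow> X (f + h) = X f + X h"
  and vf_scale: "X \<in> \<X> \<Longrightarrow> f \<in> \<F> \<Longrightarrow> X ((\<lambda>_. c) * f) = (\<lambda>_. c) * X f"
  and vf_mult: "X \<in> \<X> \<Longrightarrow> f \<in> \<F> \<Longrightarrow> h \<in> \<F> \<Longrightarrow> X (f * h) = X f * h + f * X h"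
  and vf_nonsmooth: "X \<in> \<X> \<Longrightarrow> f \<notin> \<F> \<Longrightarrow> X f = 0"
  unfolding vector_fields_def by blast+

lemma vf_const:
  assumes "X \<in> \<X>" shows "X (\<lambda>_. c) = 0"
proof -
  have "X ((\<lambda>_. 1) * (\<lambda>_. 1)) = X (\<lambda>_. 1) * (\<lambda>_. 1) + (\<lambda>_. 1) * X (\<lambda>_. 1)"
    using assms by (intro vf_mult) auto
  then have "X (\<lambda>_. 1) = 0" by (simp add: fun_eq_iff times_fun_def)
  moreover have "X ((\<lambda>_. c) * (\<lambda>_. 1)) = (\<lambda>_. c) * X (\<lambda>_. 1)"
    using assms by (intro vf_scale) auto
  ultimately show ?thesis by (simp add: times_fun_def zero_fun_def)
qed

lemma vf_0: "X \<in> \<X> \<Longrightarrow> X 0 = 0"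
  using vf_const[of X 0] by (simp add: zero_fun_def)

lemma vf_uminus: "X \<in> \<X> \<Longrightarrow> f \<in> \<F> \<Longrightarrow> X (- f) = - X f"
  using vf_scale[of X f "- 1"] by (simp add: times_fun_def fun_Compl_def)

lemma vf_diff: "X \<in> \<X> \<Longrightarrow> f \<in> \<F> \<Longrightarrow> h \<in> \<F> \<Longrightarrow> X (f - h) = X f - X h"
  by (metis diff_conv_add_uminus smooth_uminus vf_add vf_uminus)

lemma vector_fieldI:
  assumes "\<And>f. f \<in> \<F> \<Longrightarrow> X f \<in> \<F>"
    and "\<And>f h. f \<in> \<F> \<Longrightarrow> h \<in> \<F> \<Longrightarrow> X (f + h) = X f + X h"
    and "\<And>c f. f \<in> \<F> \<Longrightarrow> X ((\<lambda>_. c) * f) = (\<lambda>_. c) * X f"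
    and "\<And>f h. f \<in> \<F> \<Longrightarrow> h \<in> \<F> \<Longrightarrow> X (f * h) = X f * h + f * X h"
    and "\<And>f. f \<notin> \<F> \<Longrightarrow> X f = 0"
  shows "X \<in> \<X>"
  unfolding vector_fields_def by (simp add: assms)

lemmas vf_simps = vf_add vf_scale vf_mult vf_nonsmooth vf_const vf_0 vf_uminus vf_diff

lemma add_vf [simp, intro]:
  assumes X: "X \<in> \<X>" and Y: "Y \<in> \<X>"
  shows "X + Y \<in> \<X>"
  by (rule vector_fieldI) (simp_all add: X Y vf_simps[OF X] vf_simps[OF Y] algebra_simps)

lemma smult_vf [simp, intro]:
  assumes f: "f \<in> \<F>" and X: "X \<in> \<X>"
  shows "f \<odot> X \<in> \<X>"
  by (rule vector_fieldI) (simp_all add: fsmult_def f X vf_simps[OF X] algebra_simps)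

lemma uminus_vf [simp, intro]: "X \<in> \<X> \<Longrightarrow> - X \<in> \<X>"
  using smult_vf[of "\<lambda>_. - 1" X] by (simp add: fsmult_def times_fun_def fun_Compl_def)

lemma diff_vf [simp, intro]: "X \<in> \<X> \<Longrightarrow> Y \<in> \<X> \<Longrightarrow> X - Y \<in> \<X>"
  using add_vf[of X "- Y"] by simp

lemma zero_vf [simp]: "0 \<in> \<X>"
  by (rule vector_fieldI) (simp_all add: fun_eq_iff)

lemma bracket_vf [simp, intro]:
  assumes X: "X \<in> \<X>" and Y: "Y \<in> \<X>"
  shows "lie_bracket X Y \<in> \<X>"
  by (rule vector_fieldI)
    (simp_all add: lie_bracket_def X Y vf_simps[OF X] vf_simps[OF Y] algebra_simps)

end


section \<open>Tensor fields and connections\<close>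

lemma fsmult_add_right: "f \<odot> (X + Y) = f \<odot> X + f \<odot> Y"
  and fsmult_diff_right: "f \<odot> (X - Y) = f \<odot> X - f \<odot> Y"
  and fsmult_fsmult: "f \<odot> (h \<odot> X) = (f * h) \<odot> X"
  and fsmult_0_left [simp]: "0 \<odot> X = 0"
  and fsmult_0_right [simp]: "f \<odot> 0 = 0"
  by (simp_all add: fsmult_def fun_eq_iff algebra_simps)

lemma fsmult_const_0 [simp]: "(\<lambda>_. 0) \<odot> X = 0"
  and fsmult_const_1 [simp]: "(\<lambda>_. 1) \<odot> X = X"
  by (simp_all add: fsmult_def fun_eq_iff)

text \<open>The elements of the type \<open>3\<close> are residues: the index \<open>0\<close> is also the numeral \<open>3\<close>.\<close>

lemma numeral_3_eq_0: "(3 :: 3) = 0"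
  by simp

lemma sum_UNIV_3: "sum f (UNIV :: 3 set) = f 0 + f 1 + f 2"
  by (simp add: sum_3 numeral_3_eq_0 algebra_simps)

lemma all_3: "(\<forall>i :: 3. P i) \<longleftrightarrow> P 0 \<and> P 1 \<and> P 2"
  using forall_3[of P] by (simp add: numeral_3_eq_0) blast

lemma lincomb_3: "lincomb c (e :: 3 \<Rightarrow> 'm vfield) = c 0 \<odot> e 0 + c 1 \<odot> e 1 + c 2 \<odot> e 2"
  by (simp add: lincomb_def sum_UNIV_3)

lemma matrix_inv_involution:
  fixes M :: "real ^ 'n ^ 'n"
  assumes M: "M ** M = mat 1"
  shows "matrix_inv M = M"
  unfolding matrix_inv_def
proof (rule some_equality)
  fix B
  assume B: "M ** B = mat 1 \<and> B ** M = mat 1"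
  have "B = (M ** M) ** B" by (simp add: M)
  also have "\<dots> = M ** (M ** B)" by (simp add: matrix_mul_assoc)
  finally show "B = M" using B by simp
qed (simp add: M)

context smooth_manifold
begin

lemma conn_vf: "linear_connection A D \<Longrightarrow> X \<in> \<X> \<Longrightarrow> Y \<in> \<X> \<Longrightarrow> D X Y \<in> \<X>"
  and conn_add_left: "linear_connection A D \<Longrightarrow> X \<in> \<X> \<Longrightarrow> Y \<in> \<X> \<Longrightarrow> Z \<in> \<X>
    \<Longrightarrow> D (X + Y) Z = D X Z + D Y Z"
  and conn_add_right: "linear_connection A D \<Longrightarrow> X \<in> \<X> \<Longrightarrow> Y \<in> \<X> \<Longrightarrow> Z \<in> \<X>
    \<Longrightarrow> D X (Y + Z) = D X Y + D X Z"
  and conn_smult_left: "linear_connection A D \<Longrightarrow> f \<in> \<F> \<Longrightarrow> X \<in> \<X> \<Longrightarrow> Y \<in> \<X>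
    \<Longrightarrow> D (f \<odot> X) Y = f \<odot> D X Y"
  and conn_smult_right: "linear_connection A D \<Longrightarrow> f \<in> \<F> \<Longrightarrow> X \<in> \<X> \<Longrightarrow> Y \<in> \<X>
    \<Longrightarrow> D X (f \<odot> Y) = X f \<odot> Y + f \<odot> D X Y"
  unfolding linear_connection_def by blast+

lemma endo_vf: "endo_field A \<phi> \<Longrightarrow> X \<in> \<X> \<Longrightarrow> \<phi> X \<in> \<X>"
  and endo_add: "endo_field A \<phi> \<Longrightarrow> X \<in> \<X> \<Longrightarrow> Y \<in> \<X> \<Longrightarrow> \<phi> (X + Y) = \<phi> X + \<phi> Y"
  and endo_smult: "endo_field A \<phi> \<Longrightarrow> f \<in> \<F> \<Longrightarrow> X \<in> \<X> \<Longrightarrow> \<phi> (f \<odot> X) = f \<odot> \<phi> X"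
  unfolding endo_field_def by blast+

lemma form_add: "one_form A \<omega> \<Longrightarrow> X \<in> \<X> \<Longrightarrow> Y \<in> \<X> \<Longrightarrow> \<omega> (X + Y) = \<omega> X + \<omega> Y"
  and form_smult: "one_form A \<omega> \<Longrightarrow> f \<in> \<F> \<Longrightarrow> X \<in> \<X> \<Longrightarrow> \<omega> (f \<odot> X) = f * \<omega> X"
  unfolding one_form_def by blast+

lemma form_diff:
  assumes "one_form A \<omega>" and "X \<in> \<X>" and "Y \<in> \<X>"
  shows "\<omega> (X - Y) = \<omega> X - \<omega> Y"
  using form_add[OF assms(1), of "X - Y" Y] assms by simp

lemma form_0: "one_form A \<omega> \<Longrightarrow> \<omega> 0 = 0"
  using form_diff[of \<omega> 0 0] by simp

lemma endo_0: "endo_field A \<phi> \<Longrightarrow> \<phi> 0 = 0"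
  using endo_add[of \<phi> 0 0] by simp

text \<open>
  Tensoriality of \<open>D\<phi>\<close>: the terms \<open>X f \<odot> \<phi> Y\<close> from the two derivatives cancel, so \<open>D\<phi>\<close> is
  determined by its values on a frame.
\<close>

lemma cov_endo_field_left:
  assumes D: "linear_connection A D" and \<phi>: "endo_field A \<phi>" and Y: "Y \<in> \<X>"
  shows "endo_field A (\<lambda>X. cov_endo D \<phi> X Y)"
  unfolding endo_field_def cov_endo_def
  using Y by (simp add: conn_vf[OF D] conn_add_left[OF D] conn_smult_left[OF D]
      endo_vf[OF \<phi>] endo_add[OF \<phi>] endo_smult[OF \<phi>] fsmult_diff_right)

lemma cov_endo_field_right:
  assumes D: "linear_connection A D" and \<phi>: "endo_field A \<phi>" and X: "X \<in> \<X>"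
  shows "endo_field A (cov_endo D \<phi> X)"
  unfolding endo_field_def cov_endo_def
  using X by (simp add: conn_vf[OF D] conn_add_right[OF D] conn_smult_right[OF D]
      endo_vf[OF \<phi>] endo_add[OF \<phi>] endo_smult[OF \<phi>] fsmult_diff_right)

text \<open>
  The Koszul formula for three fields with constant mutual inner products, so that the derivatives
  of the metric coefficients drop out. The torsion identity for the three pairs of fields expands
  the right-hand side, and metricity cancels all but two equal terms.
\<close>

lemma koszul:
  assumes LC: "levi_civita A g D" and g: "pseudo_riemannian A g"
    and X: "X \<in> \<X>" and Y: "Y \<in> \<X>" and Z: "Z \<in> \<X>"
    and XY: "g X Y = (\<lambda>_. c)" and YZ: "g Y Z = (\<lambda>_. c')" and ZX: "g Z X = (\<lambda>_. c'')"
  shows "2 * g (D X Y) Z p = g (lie_bracket X Y) Z p - g (lie_bracket Y Z) X p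
    + g (lie_bracket Z X) Y p"
proof -
  have D: "linear_connection A D" using LC unfolding levi_civita_def by blast
  have form: "one_form A (g U)" and g_comm: "g U W = g W U" if "U \<in> \<X>" "W \<in> \<X>" for U W
    using g that unfolding pseudo_riemannian_def by blast+
  have br: "g (lie_bracket U W) T p = g T (D U W) p - g T (D W U) p"
    if U: "U \<in> \<X>" and W: "W \<in> \<X>" and T: "T \<in> \<X>" for U W T
  proof -
    have "torsion D U W = 0" using LC U W unfolding levi_civita_def by blast
    then have "lie_bracket U W = D U W - D W U" unfolding torsion_def by (metis right_minus_eq)
    moreover have "g (D U W - D W U) T = g T (D U W - D W U)"
      by (rule g_comm[OF diff_vf[OF conn_vf[OF D U W] conn_vf[OF D W U]] T])
    ultimately show ?thesis
      using form_diff[OF form[OF T T] conn_vf[OF D U W] conn_vf[OF D W U]] by simp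
  qed
  have met: "g T (D U W) p + g W (D U T) p = 0"
    if U: "U \<in> \<X>" and W: "W \<in> \<X>" and T: "T \<in> \<X>" and c: "g W T = (\<lambda>_. c)" for U W T c
  proof -
    have "cov_bilinear D g U W T = 0" using LC U W T unfolding levi_civita_def by blast
    then have "U (g W T) p - g (D U W) T p - g W (D U T) p = 0"
      by (simp add: cov_bilinear_def fun_eq_iff)
    moreover have "U (g W T) p = 0" by (simp add: c vf_const[OF U])
    ultimately show ?thesis using g_comm[OF conn_vf[OF D U W] T] by simp
  qed
  show ?thesis
    using br[OF X Y Z] br[OF Y Z X] br[OF Z X Y] met[OF X Y Z YZ] met[OF Y Z X ZX]
      met[OF Z X Y XY] g_comm[OF conn_vf[OF D X Y] Z] by simp
qed

end


section \<open>Fields with constant components in the frame\<close>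

text \<open>
  The manifold enters through its frame alone: the constant brackets, the constant metric
  coefficients and the action of the structure tensors on the frame.
\<close>

locale B_metric_frame = smooth_manifold A
  for A :: "('g::topological_space, 3) atlas" +
  fixes e :: "3 \<Rightarrow> 'g vfield" and a b :: real
    and \<phi> :: "'g vfield \<Rightarrow> 'g vfield"
    and \<eta> :: "'g vfield \<Rightarrow> 'g \<Rightarrow> real" and g :: "'g vfield \<Rightarrow> 'g vfield \<Rightarrow> 'g \<Rightarrow> real"
    and nabla :: "'g connection"
  assumes frame: "global_basis A e"
    and bracket_01: "lie_bracket (e 0) (e 1) = (\<lambda>_. - b) \<odot> e 1 - (\<lambda>_. a) \<odot> e 2"
    and bracket_02: "lie_bracket (e 0) (e 2) = (\<lambda>_. a) \<odot> e 1 - (\<lambda>_. b) \<odot> e 2"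
    and bracket_12: "lie_bracket (e 1) (e 2) = 0"
    and B_metric: "almost_contact_B_metric A \<phi> (e 0) \<eta> g"
    and phi_e: "\<phi> (e 0) = 0" "\<phi> (e 1) = e 2" "\<phi> (e 2) = - e 1"
    and eta_e: "\<eta> (e 0) = 1" "\<eta> (e 1) = 0" "\<eta> (e 2) = 0"
    and g_e: "g (e 0) (e 0) = 1" "g (e 1) (e 1) = 1" "g (e 2) (e 2) = - 1"
      "g (e 0) (e 1) = 0" "g (e 0) (e 2) = 0" "g (e 1) (e 2) = 0"
    and levi_civita: "levi_civita A g nabla"
begin

lemma endo_phi: "endo_field A \<phi>" and form_eta: "one_form A \<eta>" and metric: "pseudo_riemannian A g"
  and g_phi_phi: "X \<in> \<X> \<Longrightarrow> Y \<in> \<X> \<Longrightarrow> g (\<phi> X) (\<phi> Y) = - g X Y + \<eta> X * \<eta> Y"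
  using B_metric unfolding almost_contact_B_metric_def by blast+

lemma conn: "linear_connection A nabla"
  using levi_civita unfolding levi_civita_def by blast

lemma form_g: "X \<in> \<X> \<Longrightarrow> one_form A (g X)" and g_sym: "X \<in> \<X> \<Longrightarrow> Y \<in> \<X> \<Longrightarrow> g X Y = g Y X"
  using metric unfolding pseudo_riemannian_def by blast+

lemma e_vf [simp]: "e i \<in> \<X>"
  using frame unfolding global_basis_def by blast

lemma g_add_right: "X \<in> \<X> \<Longrightarrow> Y \<in> \<X> \<Longrightarrow> Z \<in> \<X> \<Longrightarrow> g X (Y + Z) = g X Y + g X Z"
  and g_smult_right: "X \<in> \<X> \<Longrightarrow> Y \<in> \<X> \<Longrightarrow> f \<in> \<F> \<Longrightarrow> g X (f \<odot> Y) = f * g X Y"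
  by (simp_all add: form_add[OF form_g] form_smult[OF form_g])

lemma g_add_left: "X \<in> \<X> \<Longrightarrow> Y \<in> \<X> \<Longrightarrow> Z \<in> \<X> \<Longrightarrow> g (X + Y) Z = g X Z + g Y Z"
  using g_add_right[of Z X Y] g_sym[of Z] by simp

lemma g_smult_left: "X \<in> \<X> \<Longrightarrow> Y \<in> \<X> \<Longrightarrow> f \<in> \<F> \<Longrightarrow> g (f \<odot> X) Y = f * g X Y"
  using g_smult_right[of Y X f] g_sym[of Y] by simp

lemma g_0 [simp]: "X \<in> \<X> \<Longrightarrow> g X 0 = 0" "X \<in> \<X> \<Longrightarrow> g 0 X = 0"
  using form_0[OF form_g, of X] g_sym[of 0 X] by simp_all

lemma g_uminus_left:
  assumes "X \<in> \<X>" and "Y \<in> \<X>"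
  shows "g (- X) Y = - g X Y"
proof -
  have "g (- X) Y + g X Y = g (- X + X) Y"
    using assms g_add_left[of "- X" X Y] by simp
  also have "\<dots> = 0" using assms by simp
  finally show ?thesis by (rule minus_unique[symmetric, OF trans[OF add.commute]])
qed

lemmas g_simps = g_add_left g_add_right g_smult_left g_smult_right

lemma g_e': "g (e 1) (e 0) = 0" "g (e 2) (e 0) = 0" "g (e 2) (e 1) = 0"
  using g_e g_sym by (metis e_vf)+

lemma frame_components:
  assumes "X \<in> \<X>"
  obtains c :: "3 \<Rightarrow> 'g \<Rightarrow> real" where "\<forall>i. c i \<in> \<F>"
    and "X = c 0 \<odot> e 0 + c 1 \<odot> e 1 + c 2 \<odot> e 2"
proof -
  obtain c where "(\<forall>i. c i \<in> \<F>) \<and> X = lincomb c e"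
    using frame assms unfolding global_basis_def by (metis (no_types, lifting))
  then show thesis using that[of c] unfolding lincomb_3 by simp
qed

text \<open>
  The components of a field are its inner products with the orthonormal frame; the sign of the
  last one is that of \<open>g (e 2) (e 2) = - 1\<close>.
\<close>

lemma frame_expansion:
  assumes "X \<in> \<X>"
  shows "X = g X (e 0) \<odot> e 0 + g X (e 1) \<odot> e 1 + (- g X (e 2)) \<odot> e 2"
proof -
  obtain c :: "3 \<Rightarrow> 'g \<Rightarrow> real" where c: "\<forall>i. c i \<in> \<F>"
      and X: "X = c 0 \<odot> e 0 + c 1 \<odot> e 1 + c 2 \<odot> e 2"
    using assms by (rule frame_components)
  have c_eq: "g X (e 0) = c 0" "g X (e 1) = c 1" "- g X (e 2) = c 2"
    unfolding X using c by (simp_all add: g_simps g_e g_e')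
  show ?thesis unfolding c_eq by (rule X)
qed

text \<open>
  On the group these are the left-invariant fields. They are closed under \<open>\<phi>\<close>, the
  bracket and \<open>\<nabla>\<close>, which reduces the computations on the frame to real arithmetic.
\<close>

definition const_comb :: "real \<Rightarrow> real \<Rightarrow> real \<Rightarrow> 'g vfield" where
  "const_comb p q r = (\<lambda>_. p) \<odot> e 0 + (\<lambda>_. q) \<odot> e 1 + (\<lambda>_. r) \<odot> e 2"

lemma const_comb_vf [simp]: "const_comb p q r \<in> \<X>"
  by (simp add: const_comb_def)

lemma e_eq_const_comb: "e 0 = const_comb 1 0 0" "e 1 = const_comb 0 1 0" "e 2 = const_comb 0 0 1"
  by (simp_all add: const_comb_def)

lemma const_comb_add: "const_comb p q r + const_comb p' q' r' = const_comb (p + p') (q + q') (r + r')"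
  and const_comb_diff: "const_comb p q r - const_comb p' q' r' = const_comb (p - p') (q - q') (r - r')"
  and const_comb_uminus: "- const_comb p q r = const_comb (- p) (- q) (- r)"
  and const_comb_scale: "(\<lambda>_. c) \<odot> const_comb p q r = const_comb (c * p) (c * q) (c * r)"
  and const_comb_0: "0 = const_comb 0 0 0"
  by (simp_all add: const_comb_def fsmult_def fun_eq_iff algebra_simps)

lemma g_const_comb: "g (const_comb p q r) (const_comb p' q' r') = (\<lambda>_. p * p' + q * q' - r * r')"
  unfolding const_comb_def by (simp add: g_simps g_e g_e' fun_eq_iff algebra_simps)

lemma eta_const_comb: "\<eta> (const_comb p q r) = (\<lambda>_. p)"
  unfolding const_comb_def
  by (simp add: form_add[OF form_eta] form_smult[OF form_eta] eta_e fun_eq_iff)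

lemma phi_const_comb: "\<phi> (const_comb p q r) = const_comb 0 (- r) q"
  unfolding const_comb_def
  by (simp add: endo_add[OF endo_phi] endo_smult[OF endo_phi] phi_e)
    (simp add: fsmult_def fun_eq_iff)

text \<open>Nondegeneracy: the inner products with the frame recover the coefficients.\<close>

lemma const_comb_inject: "const_comb p q r = const_comb p' q' r' \<longleftrightarrow> p = p' \<and> q = q' \<and> r = r'"
proof
  assume "const_comb p q r = const_comb p' q' r'"
  then have "g (const_comb p q r) (const_comb u v w) = g (const_comb p' q' r') (const_comb u v w)"
    for u v w by simp
  then have "p * u + q * v - r * w = p' * u + q' * v - r' * w" for u v w
    unfolding g_const_comb by (metis (no_types))
  from this[of 1 0 0] this[of 0 1 0] this[of 0 0 1] show "p = p' \<and> q = q' \<and> r = r'" by simp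
qed simp

lemma bracket_const_comb:
  "lie_bracket (const_comb p q r) (const_comb p' q' r') =
    const_comb 0 (- b * (p * q' - q * p') + a * (p * r' - r * p'))
      (- a * (p * q' - q * p') - b * (p * r' - r * p'))"
  (is "?L = ?R")
proof -
  \<comment> \<open>Both sides are \<open>0\<close> on a function that is not smooth.\<close>
  have "?L f = ?R f" for f
  proof (cases "f \<in> \<F>")
    case True
    have br: "e 0 (e 1 f) = e 1 (e 0 f) + ((\<lambda>_. - b) * e 1 f - (\<lambda>_. a) * e 2 f)"
      "e 0 (e 2 f) = e 2 (e 0 f) + ((\<lambda>_. a) * e 1 f - (\<lambda>_. b) * e 2 f)"
      "e 1 (e 2 f) = e 2 (e 1 f)"
      using fun_cong[OF bracket_01, of f] fun_cong[OF bracket_02, of f]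
        fun_cong[OF bracket_12, of f]
      by (simp_all add: lie_bracket_def fsmult_def algebra_simps)
    show ?thesis
      using True by (simp add: const_comb_def lie_bracket_def fsmult_def vf_add vf_scale br)
        (simp add: fun_eq_iff algebra_simps)
  next
    case False
    then show ?thesis
      using vf_nonsmooth[of "const_comb _ _ _" f] vf_nonsmooth[of ?L f] by simp
  qed
  then show ?thesis by (rule ext)
qed

text \<open>
  The Koszul formula gives the inner products of \<open>\<nabla>\<^sub>X Y\<close> with all constant fields, hence its
  components.
\<close>

lemma nabla_const_comb:
  "nabla (const_comb p q r) (const_comb p' q' r') =
    const_comb (- b * q * q' + a * q * r' + a * r * q' + b * r * r')
      (p' * (b * q - a * r)) (p' * (a * q + b * r))"
proof -
  let ?Z = "nabla (const_comb p q r) (const_comb p' q' r')"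
  let ?A = "- b * q * q' + a * q * r' + a * r * q' + b * r * r'"
  let ?B = "p' * (b * q - a * r)" and ?C = "p' * (a * q + b * r)"
  have Z: "?Z \<in> \<X>" by (simp add: conn_vf[OF conn])
  have inner: "g ?Z (const_comb u v w) = (\<lambda>_. ?A * u + ?B * v - ?C * w)" for u v w
  proof
    fix x
    have "2 * g ?Z (const_comb u v w) x =
        g (lie_bracket (const_comb p q r) (const_comb p' q' r')) (const_comb u v w) x
        - g (lie_bracket (const_comb p' q' r') (const_comb u v w)) (const_comb p q r) x
        + g (lie_bracket (const_comb u v w) (const_comb p q r)) (const_comb p' q' r') x"
      by (rule koszul[where g = g, OF levi_civita metric const_comb_vf const_comb_vf
            const_comb_vf g_const_comb g_const_comb g_const_comb])
    also have "\<dots> = 2 * (?A * u + ?B * v - ?C * w)"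
      unfolding bracket_const_comb g_const_comb by (simp add: algebra_simps)
    finally show "g ?Z (const_comb u v w) x = ?A * u + ?B * v - ?C * w" by simp
  qed
  have components: "g ?Z (e 0) = (\<lambda>_. ?A)" "g ?Z (e 1) = (\<lambda>_. ?B)" "g ?Z (e 2) = (\<lambda>_. - ?C)"
    unfolding e_eq_const_comb inner by simp_all
  have "?Z = (\<lambda>_. ?A) \<odot> e 0 + (\<lambda>_. ?B) \<odot> e 1 + (- (\<lambda>_. - ?C)) \<odot> e 2"
    using frame_expansion[OF Z] unfolding components .
  then show ?thesis by (simp add: const_comb_def fun_Compl_def)
qed

lemmas const_comb_simps = e_eq_const_comb const_comb_add const_comb_diff const_comb_uminus
  const_comb_scale g_const_comb eta_const_comb phi_const_comb bracket_const_comb nabla_const_comb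


section \<open>The fundamental tensor and its classes\<close>

text \<open>The diagonal matrix with entries \<open>\<plusminus>1\<close> is its own inverse.\<close>

lemma metric_inv_e: "metric_inv g e i j = (\<lambda>_. if i = j then (if i = 2 then -1 else 1) else 0)"
proof -
  define H :: "real ^ 3 ^ 3" where "H = (\<chi> k l. if k = l then (if k = 2 then -1 else 1) else 0)"
  have "(\<chi> k l. g (e k) (e l) p) = H" for p
    unfolding vec_eq_iff all_3 H_def by (simp add: g_e g_e')
  moreover have "H ** H = mat 1"
    unfolding vec_eq_iff all_3 H_def by (simp add: matrix_matrix_mult_def mat_def sum_UNIV_3)
  ultimately show ?thesis
    by (simp add: metric_inv_def matrix_inv_involution) (simp add: H_def)
qed

lemma metric_trace_e: "metric_trace g e B = B (e 0) (e 0) + B (e 1) (e 1) - B (e 2) (e 2)"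
  by (simp add: metric_trace_def sum_UNIV_3 metric_inv_e fun_eq_iff)

lemma cov_endo_const_comb:
  "cov_endo nabla \<phi> (const_comb p q r) (const_comb p' q' r') =
    const_comb ((a * q + b * r) * q' + (b * q - a * r) * r')
      (p' * (a * q + b * r)) (- p' * (b * q - a * r))"
  by (simp add: cov_endo_def const_comb_simps const_comb_inject algebra_simps)

lemma lee_form_e0: "lee_form g nabla \<phi> e (e 0) = (\<lambda>_. 2 * a)"
  and lee_form_star_e0: "lee_form_star g nabla \<phi> e (e 0) = (\<lambda>_. 2 * b)"
  by (simp_all add: lee_form_def lee_form_star_def metric_trace_e fundamental_tensor_def
      cov_endo_const_comb const_comb_simps fun_eq_iff)

lemma sqnorm: "sqnorm_nabla_phi g nabla \<phi> e = (\<lambda>_. 4 * (a\<^sup>2 - b\<^sup>2))"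
  by (simp add: sqnorm_nabla_phi_def sum_UNIV_3 metric_inv_e cov_endo_const_comb const_comb_simps fun_eq_iff
      power2_eq_square algebra_simps)

text \<open>
  This is \<open>F = F\<^sub>4 + F\<^sub>5\<close>, as \<open>a\<close> and \<open>b\<close> are \<open>\<theta>\<^sub>0 / 2\<close> and \<open>\<theta>\<^sup>*\<^sub>0 / 2\<close>. By tensoriality only the values
  of \<open>\<nabla>\<phi>\<close> on the frame enter.
\<close>

lemma fundamental_tensor_lincomb:
  assumes x: "\<forall>i. x i \<in> \<F>" and y: "\<forall>i. y i \<in> \<F>" and z: "\<forall>i. z i \<in> \<F>"
  shows "fundamental_tensor g nabla \<phi> (lincomb x e) (lincomb y e) (lincomb z e) =
    (\<lambda>_. a) * (x 1 * (y 0 * z 1 + y 1 * z 0) - x 2 * (y 0 * z 2 + y 2 * z 0)) +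
    (\<lambda>_. b) * (x 1 * (y 0 * z 2 + y 2 * z 0) + x 2 * (y 0 * z 1 + y 1 * z 0))"
proof -
  note left = cov_endo_field_left[OF conn endo_phi]
    and right = cov_endo_field_right[OF conn endo_phi]
  have vf: "lincomb y e \<in> \<X>" using y by (simp add: lincomb_3)
  have ce: "cov_endo nabla \<phi> (e i) (e j) \<in> \<X>" for i j
    using endo_vf[OF right] by simp
  have "cov_endo nabla \<phi> (lincomb x e) (lincomb y e) =
      (\<Sum>i\<in>UNIV. \<Sum>j\<in>UNIV. (x i * y j) \<odot> cov_endo nabla \<phi> (e i) (e j))"
  proof -
    have "cov_endo nabla \<phi> (lincomb x e) (lincomb y e) =
      x 0 \<odot> cov_endo nabla \<phi> (e 0) (lincomb y e) + x 1 \<odot> cov_endo nabla \<phi> (e 1) (lincomb y e) +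
      x 2 \<odot> cov_endo nabla \<phi> (e 2) (lincomb y e)"
      using x unfolding lincomb_3[of x]
      by (simp add: endo_add[OF left[OF vf]] endo_smult[OF left[OF vf]])
    also have "\<dots> = (\<Sum>i\<in>UNIV. \<Sum>j\<in>UNIV. (x i * y j) \<odot> cov_endo nabla \<phi> (e i) (e j))"
      using y unfolding lincomb_3[of y]
      by (simp add: endo_add[OF right] endo_smult[OF right] sum_UNIV_3 fsmult_add_right fsmult_fsmult)
    finally show ?thesis .
  qed
  then show ?thesis
    using x y z by (simp add: fundamental_tensor_def lincomb_3[of z] sum_UNIV_3 g_simps ce)
      (simp add: const_comb_simps cov_endo_const_comb fun_eq_iff algebra_simps)
qed

lemma class_F0_iff: "class_F0 A \<phi> g nabla \<longleftrightarrow> a = 0 \<and> b = 0"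
proof
  assume F0: "class_F0 A \<phi> g nabla"
  then have "fundamental_tensor g nabla \<phi> (e 1) (e 1) (e 0) = 0"
    "fundamental_tensor g nabla \<phi> (e 1) (e 2) (e 0) = 0"
    unfolding class_F0_def by simp_all
  then show "a = 0 \<and> b = 0"
    by (simp add: fundamental_tensor_def const_comb_simps cov_endo_const_comb fun_eq_iff)
next
  assume ab: "a = 0 \<and> b = 0"
  have "fundamental_tensor g nabla \<phi> X Y Z = 0"
    if X: "X \<in> \<X>" and Y: "Y \<in> \<X>" and Z: "Z \<in> \<X>" for X Y Z
  proof -
    obtain x :: "3 \<Rightarrow> 'g \<Rightarrow> real" where x: "\<forall>i. x i \<in> \<F>"
        "X = x 0 \<odot> e 0 + x 1 \<odot> e 1 + x 2 \<odot> e 2"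
      using X by (rule frame_components)
    obtain y :: "3 \<Rightarrow> 'g \<Rightarrow> real" where y: "\<forall>i. y i \<in> \<F>"
        "Y = y 0 \<odot> e 0 + y 1 \<odot> e 1 + y 2 \<odot> e 2"
      using Y by (rule frame_components)
    obtain z :: "3 \<Rightarrow> 'g \<Rightarrow> real" where z: "\<forall>i. z i \<in> \<F>"
        "Z = z 0 \<odot> e 0 + z 1 \<odot> e 1 + z 2 \<odot> e 2"
      using Z by (rule frame_components)
    show ?thesis
      using fundamental_tensor_lincomb[OF x(1) y(1) z(1)] ab
      by (simp add: x(2) y(2) z(2) lincomb_3 fun_eq_iff)
  qed
  then show "class_F0 A \<phi> g nabla" unfolding class_F0_def by blast
qed

lemma class_F4_iff: "class_F4 A \<phi> g nabla e \<longleftrightarrow> b = 0"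
proof
  assume F4: "class_F4 A \<phi> g nabla e"
  let ?d = "\<lambda>j i. (\<lambda>_. of_bool (i = j)) :: 'g \<Rightarrow> real"
  \<comment> \<open>At \<open>(e\<^sub>1, e\<^sub>2, e\<^sub>0)\<close> the \<open>F\<^sub>4\<close> part of \<open>F\<close> vanishes and the \<open>F\<^sub>5\<close> part is \<open>b\<close>.\<close>
  have "fundamental_tensor g nabla \<phi> (lincomb (?d 1) e) (lincomb (?d 2) e) (lincomb (?d 0) e) = 0"
    using F4[unfolded class_F4_def, rule_format, of "?d 1" "?d 2" "?d 0"]
    by (simp add: fun_eq_iff)
  then show "b = 0"
    by (simp add: fundamental_tensor_lincomb fun_eq_iff)
next
  assume "b = 0"
  then show "class_F4 A \<phi> g nabla e"
    by (simp add: class_F4_def fundamental_tensor_lincomb lee_form_e0 fun_eq_iff)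
qed

lemma class_F5_iff: "class_F5 A \<phi> g nabla e \<longleftrightarrow> a = 0"
proof
  assume F5: "class_F5 A \<phi> g nabla e"
  let ?d = "\<lambda>j i. (\<lambda>_. of_bool (i = j)) :: 'g \<Rightarrow> real"
  \<comment> \<open>At \<open>(e\<^sub>1, e\<^sub>1, e\<^sub>0)\<close> the \<open>F\<^sub>5\<close> part of \<open>F\<close> vanishes and the \<open>F\<^sub>4\<close> part is \<open>a\<close>.\<close>
  have "fundamental_tensor g nabla \<phi> (lincomb (?d 1) e) (lincomb (?d 1) e) (lincomb (?d 0) e) = 0"
    using F5[unfolded class_F5_def, rule_format, of "?d 1" "?d 1" "?d 0"]
    by (simp add: fun_eq_iff)
  then show "a = 0"
    by (simp add: fundamental_tensor_lincomb fun_eq_iff)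
next
  assume "a = 0"
  then show "class_F5 A \<phi> g nabla e"
    by (simp add: class_F5_def fundamental_tensor_lincomb lee_form_star_e0 fun_eq_iff)
qed


section \<open>Natural connections\<close>

lemma phiB_connection_e: "phiB_connection \<phi> (e 0) \<eta> nabla (e i) (e j) = 0"
proof -
  have "\<forall>i j. phiB_connection \<phi> (e 0) \<eta> nabla (e i) (e j) = 0"
    unfolding all_3 phiB_connection_def cov_form_def
    by (simp add: const_comb_simps cov_endo_const_comb const_comb_inject
        vf_const[OF const_comb_vf] fun_diff_def const_comb_0)
  then show ?thesis by blast
qed

text \<open>The form \<open>\<eta>\<close> is dual to \<open>\<xi> = e 0\<close>, as both sides agree on the frame.\<close>

lemma eta_eq_g:
  assumes "X \<in> \<X>"
  shows "\<eta> X = g X (e 0)"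
proof -
  obtain c :: "3 \<Rightarrow> 'g \<Rightarrow> real" where c: "\<forall>i. c i \<in> \<F>"
      and X: "X = c 0 \<odot> e 0 + c 1 \<odot> e 1 + c 2 \<odot> e 2"
    using assms by (rule frame_components)
  show ?thesis
    unfolding X using c
    by (simp add: g_simps g_e g_e' form_add[OF form_eta] form_smult[OF form_eta] eta_e)
qed

text \<open>
  Preserving \<open>\<phi>\<close> ties \<open>D\<^sub>X e\<^sub>2\<close> to \<open>D\<^sub>X e\<^sub>1\<close>. Since \<open>\<phi>\<close> is an anti-isometry on the kernel of \<open>\<eta>\<close>,
  the vanishing derivative of \<open>g (e 1) (e 2)\<close> is \<open>2 g(D\<^sub>X e\<^sub>1, e\<^sub>2)\<close>, so \<open>D\<^sub>X e\<^sub>1\<close> has no component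
  along \<open>e\<^sub>2\<close>; the other two vanish by \<open>D\<eta> = 0\<close> and by the constant length of \<open>e\<^sub>1\<close>.
\<close>

lemma natural_connection_e:
  assumes D: "natural_connection A \<phi> (e 0) \<eta> g D" and X: "X \<in> \<X>"
  shows "D X (e j) = 0"
proof -
  have D_conn: "linear_connection A D" and D_e0: "D X (e 0) = 0"
    using D X unfolding natural_connection_def by simp_all
  have D_phi: "D X (\<phi> Y) = \<phi> (D X Y)" and D_eta: "X (\<eta> Y) = \<eta> (D X Y)" if "Y \<in> \<X>" for Y
    using D X that unfolding natural_connection_def cov_endo_def cov_form_def by simp_all
  have D_g: "X (g Y Z) = g (D X Y) Z + g Y (D X Z)" if "Y \<in> \<X>" and "Z \<in> \<X>" for Y Z
  proof -
    have "cov_bilinear D g X Y Z = 0"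
      using D X that unfolding natural_connection_def by simp
    then show ?thesis by (simp add: cov_bilinear_def fun_eq_iff algebra_simps)
  qed
  let ?Z = "D X (e 1)"
  have Z: "?Z \<in> \<X>" using conn_vf[OF D_conn X] by simp
  have const: "X 0 = 0" "X 1 = 0"
    using vf_const[OF X] by (simp_all add: vf_0[OF X] one_fun_def)
  have "\<eta> ?Z = 0" using D_eta[of "e 1"] by (simp add: eta_e const)
  then have "g ?Z (e 0) = 0" using eta_eq_g[OF Z] by simp
  moreover have "g ?Z (e 1) = 0"
    using D_g[of "e 1" "e 1"] g_sym[OF Z] by (simp add: g_e const fun_eq_iff)
  moreover have "g ?Z (e 2) = 0"
  proof -
    have "D X (e 2) = \<phi> ?Z" using D_phi[of "e 1"] by (simp add: phi_e)
    then have "g ?Z (e 2) + g (e 1) (\<phi> ?Z) = 0"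
      using D_g[of "e 1" "e 2"] by (simp add: g_e const)
    moreover have "g (\<phi> (e 2)) (\<phi> ?Z) = - g (e 2) ?Z"
      using g_phi_phi[of "e 2" ?Z] Z by (simp add: eta_e)
    moreover have "g (\<phi> (e 2)) (\<phi> ?Z) = - g (e 1) (\<phi> ?Z)"
      using g_uminus_left[of "e 1" "\<phi> ?Z"] endo_vf[OF endo_phi Z] by (simp add: phi_e)
    ultimately show ?thesis using g_sym[OF Z, of "e 2"] by (simp add: fun_eq_iff)
  qed
  ultimately have Z_0: "?Z = 0"
    using frame_expansion[OF Z] by (simp only:) simp
  moreover have "D X (e 2) = 0"
    using D_phi[of "e 1"] by (simp add: phi_e Z_0 endo_0[OF endo_phi])
  ultimately show ?thesis
    using D_e0 all_3[of "\<lambda>j. D X (e j) = 0"] e_vf by blast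
qed


section \<open>Curvature\<close>

lemma ricci_e:
  "ricci g nabla e (e 0) (e 0) = (\<lambda>_. 2 * (a\<^sup>2 - b\<^sup>2))"
  "ricci g nabla e (e 1) (e 1) = (\<lambda>_. - 2 * b\<^sup>2)"
  "ricci g nabla e (e 2) (e 2) = (\<lambda>_. 2 * b\<^sup>2)"
  by (simp_all add: ricci_def metric_trace_e curvature_def const_comb_simps fun_eq_iff
      power2_eq_square algebra_simps)

lemma scalar_curvature_eq: "scalar_curvature g nabla e = (\<lambda>_. 2 * (a\<^sup>2 - 3 * b\<^sup>2))"
  unfolding scalar_curvature_def metric_trace_e ricci_e
  by (simp add: fun_eq_iff algebra_simps)

lemma ricci_star_e:
  "ricci_star g nabla \<phi> e (e 0) (e 0) = (\<lambda>_. 4 * (a * b))"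
  "ricci_star g nabla \<phi> e (e 1) (e 1) = 0"
  "ricci_star g nabla \<phi> e (e 2) (e 2) = 0"
  "ricci_star g nabla \<phi> e (e 1) (e 2) = (\<lambda>_. - (a\<^sup>2 + b\<^sup>2))"
  by (simp_all add: ricci_star_def metric_trace_e curvature_def const_comb_simps fun_eq_iff
      power2_eq_square algebra_simps)

lemma scalar_curvature_star_eq: "scalar_curvature_star g nabla \<phi> e = (\<lambda>_. 4 * (a * b))"
  unfolding scalar_curvature_star_def metric_trace_e ricci_star_e
  by (simp add: fun_eq_iff)

text \<open>A single component of \<open>R\<close> that is nonzero unless \<open>a = b = 0\<close>.\<close>

lemma curvature_e: "curvature nabla (e 1) (e 2) (e 1) = const_comb 0 0 (a\<^sup>2 + b\<^sup>2)"
  by (simp add: curvature_def const_comb_simps const_comb_inject power2_eq_square algebra_simps)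

text \<open>
  For a parallel frame the connection differentiates the components, \<open>\<nabla>\<^sub>X (c\<^sub>i e\<^sub>i) = X(c\<^sub>i) e\<^sub>i\<close>,
  so the curvature vanishes by the definition of \<open>[X, Y]\<close> as a commutator of derivations.
\<close>

lemma flat_if_parallel:
  assumes "\<And>i j. nabla (e i) (e j) = 0"
  shows "flat A nabla"
proof -
  have par: "nabla X (e j) = 0" if X: "X \<in> \<X>" for X j
  proof -
    obtain c :: "3 \<Rightarrow> 'g \<Rightarrow> real" where c: "\<forall>i. c i \<in> \<F>"
      and X: "X = c 0 \<odot> e 0 + c 1 \<odot> e 1 + c 2 \<odot> e 2"
      using X by (rule frame_components)
    show ?thesis
      unfolding X using c
      by (simp add: conn_add_left[OF conn] conn_smult_left[OF conn] assms)
  qed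
  have nabla: "nabla X (c 0 \<odot> e 0 + c 1 \<odot> e 1 + c 2 \<odot> e 2)
      = X (c 0) \<odot> e 0 + X (c 1) \<odot> e 1 + X (c 2) \<odot> e 2"
    if "X \<in> \<X>" and "\<forall>i. c i \<in> \<F>" for X and c :: "3 \<Rightarrow> 'g \<Rightarrow> real"
    using that by (simp add: conn_add_right[OF conn] conn_smult_right[OF conn] par)
  have "curvature nabla X Y Z = 0" if X: "X \<in> \<X>" and Y: "Y \<in> \<X>" and Z: "Z \<in> \<X>" for X Y Z
  proof -
    obtain c :: "3 \<Rightarrow> 'g \<Rightarrow> real" where c: "\<forall>i. c i \<in> \<F>"
      and Z: "Z = c 0 \<odot> e 0 + c 1 \<odot> e 1 + c 2 \<odot> e 2"
      using Z by (rule frame_components)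
    show ?thesis
      unfolding Z curvature_def
      using nabla[OF X c] nabla[OF Y c] nabla[OF bracket_vf[OF X Y] c]
        nabla[OF X, of "\<lambda>i. Y (c i)"] nabla[OF Y, of "\<lambda>i. X (c i)"] c X Y
      by (simp add: lie_bracket_def) (simp add: fsmult_def fun_eq_iff algebra_simps)
  qed
  then show ?thesis unfolding flat_def by blast
qed

lemma flat_iff: "flat A nabla \<longleftrightarrow> a = 0 \<and> b = 0"
proof
  assume "flat A nabla"
  then have "curvature nabla (e 1) (e 2) (e 1) = 0" unfolding flat_def by simp
  then show "a = 0 \<and> b = 0" unfolding curvature_e const_comb_0 const_comb_inject by simp
next
  assume "a = 0 \<and> b = 0"
  then have "\<forall>i j. nabla (e i) (e j) = 0"
    unfolding all_3 by (simp add: const_comb_simps) (simp add: const_comb_0 const_comb_inject)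
  then show "flat A nabla" by (intro flat_if_parallel) simp
qed

text \<open>The component \<open>\<rho>(e\<^sub>2, e\<^sub>2)\<close> determines \<open>b\<close> up to sign, and then \<open>\<rho>(e\<^sub>0, e\<^sub>0)\<close> determines \<open>a\<close>.\<close>

lemma ricci_flat_iff: "ricci_flat A g nabla e \<longleftrightarrow> flat A nabla"
proof
  assume "ricci_flat A g nabla e"
  then have "ricci g nabla e (e 0) (e 0) = 0" "ricci g nabla e (e 2) (e 2) = 0"
    unfolding ricci_flat_def by simp_all
  then show "flat A nabla" unfolding flat_iff ricci_e by (simp add: fun_eq_iff)
next
  assume "flat A nabla"
  then show "ricci_flat A g nabla e"
    by (simp add: ricci_flat_def flat_def ricci_def metric_trace_e)
qed

text \<open>
  The diagonal components of \<open>\<rho>\<^sup>*\<close> see only the product \<open>a b\<close>; the component at \<open>(e\<^sub>1, e\<^sub>2)\<close> is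
  definite in \<open>(a, b)\<close>.
\<close>

lemma star_ricci_flat_iff: "star_ricci_flat A \<phi> g nabla e \<longleftrightarrow> flat A nabla"
proof
  assume "star_ricci_flat A \<phi> g nabla e"
  then have "ricci_star g nabla \<phi> e (e 1) (e 2) = 0"
    unfolding star_ricci_flat_def by simp
  then have "- (a\<^sup>2 + b\<^sup>2) = 0"
    unfolding ricci_star_e by (simp only: fun_eq_iff zero_fun_apply simp_thms)
  then show "flat A nabla"
    unfolding flat_iff by (simp only: neg_equal_0_iff_equal sum_power2_eq_zero_iff)
next
  assume "flat A nabla"
  moreover have "\<phi> (e i) \<in> \<X>" for i using endo_vf[OF endo_phi] by simp
  ultimately show "star_ricci_flat A \<phi> g nabla e"
    by (simp add: star_ricci_flat_def flat_def ricci_star_def metric_trace_e)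
qed

end


section \<open>The equivalences as conditions on the structure constants\<close>

lemma const_fun_eq: "(\<lambda>_ :: 'm. x) = (\<lambda>_. y) \<longleftrightarrow> x = y"
  by (rule iffI) (drule fun_cong[of _ _ undefined], simp_all)

theorem proposition2p2:
  fixes A :: "('g::{t2_space, second_countable_topology}, 3) atlas"
    and mul :: "'g \<Rightarrow> 'g \<Rightarrow> 'g" and unit :: 'g and iv :: "'g \<Rightarrow> 'g"
    and e :: "3 \<Rightarrow> 'g vfield" and a b :: real
    and \<phi> :: "'g vfield \<Rightarrow> 'g vfield" and \<xi> :: "'g vfield"
    and \<eta> :: "'g vfield \<Rightarrow> 'g \<Rightarrow> real" and g :: "'g vfield \<Rightarrow> 'g vfield \<Rightarrow> 'g \<Rightarrow> real"
    and nabla :: "'g connection"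
  assumes "lie_group A mul unit iv" and "connected (UNIV :: 'g set)"
    and "global_basis A e" and "\<And>i. left_invariant_field mul iv (e i)"
    and "lie_bracket (e 0) (e 1) = (\<lambda>_. - b) \<odot> e 1 - (\<lambda>_. a) \<odot> e 2"
    and "lie_bracket (e 0) (e 2) = (\<lambda>_. a) \<odot> e 1 - (\<lambda>_. b) \<odot> e 2"
    and "lie_bracket (e 1) (e 2) = 0"
    and "almost_contact_B_metric A \<phi> \<xi> \<eta> g"
    and "left_invariant_structure A mul iv \<phi> \<xi> \<eta> g"
    and "\<phi> (e 0) = 0" and "\<phi> (e 1) = e 2" and "\<phi> (e 2) = - e 1" and "\<xi> = e 0"
    and "\<eta> (e 0) = 1" and "\<eta> (e 1) = 0" and "\<eta> (e 2) = 0"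
    and "g (e 0) (e 0) = 1" and "g (e 1) (e 1) = 1" and "g (e 2) (e 2) = - 1"
    and "g (e 0) (e 1) = 0" and "g (e 0) (e 2) = 0" and "g (e 1) (e 2) = 0"
    and "levi_civita A g nabla"
  shows "let \<theta>\<^sub>0 = lee_form g nabla \<phi> e (e 0); \<theta>s\<^sub>0 = lee_form_star g nabla \<phi> e (e 0) in
    ((\<forall>i j. phiB_connection \<phi> \<xi> \<eta> nabla (e i) (e j) = 0) \<and>
     (\<forall>D. phi_canonical_connection A \<phi> \<xi> \<eta> g D \<longrightarrow> (\<forall>i j. D (e i) (e j) = 0))) \<and>
    (isotropic_F0 g nabla \<phi> e \<longleftrightarrow> \<theta>\<^sub>0 = \<theta>s\<^sub>0 \<or> \<theta>\<^sub>0 = - \<theta>s\<^sub>0) \<and>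
    (flat A nabla \<longleftrightarrow> class_F0 A \<phi> g nabla) \<and>
    ((ricci_flat A g nabla e \<longleftrightarrow> flat A nabla) \<and>
     (star_ricci_flat A \<phi> g nabla e \<longleftrightarrow> flat A nabla)) \<and>
    (scalar_curvature g nabla e = 0 \<longleftrightarrow>
       \<theta>\<^sub>0 = (\<lambda>_. sqrt 3) * \<theta>s\<^sub>0 \<or> \<theta>\<^sub>0 = - ((\<lambda>_. sqrt 3) * \<theta>s\<^sub>0)) \<and>
    (scalar_curvature_star g nabla \<phi> e = 0 \<longleftrightarrow>
       class_F4 A \<phi> g nabla e \<or> class_F5 A \<phi> g nabla e)"
proof -
  interpret B_metric_frame A e a b \<phi> \<eta> g nabla
  proof unfold_locales
    show "smooth_atlas A" using assms(1) unfolding lie_group_def by blast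
    show "almost_contact_B_metric A \<phi> (e 0) \<eta> g" using assms(8) unfolding assms(13) .
  qed (fact assms)+
  have isotropic: "isotropic_F0 g nabla \<phi> e \<longleftrightarrow> a = b \<or> a = - b"
    unfolding isotropic_F0_def sqnorm by (simp add: fun_eq_iff power2_eq_iff)
  have "a\<^sup>2 - 3 * b\<^sup>2 = 0 \<longleftrightarrow> a\<^sup>2 = (sqrt 3 * b)\<^sup>2"
    by (simp add: power_mult_distrib)
  then have scalar: "scalar_curvature g nabla e = 0 \<longleftrightarrow> a = sqrt 3 * b \<or> a = - (sqrt 3 * b)"
    unfolding scalar_curvature_eq power2_eq_iff by (simp add: fun_eq_iff)
  have star: "scalar_curvature_star g nabla \<phi> e = 0 \<longleftrightarrow> b = 0 \<or> a = 0"
    unfolding scalar_curvature_star_eq by (auto simp: fun_eq_iff)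
  have theta:
    "lee_form g nabla \<phi> e (e 0) = lee_form_star g nabla \<phi> e (e 0) \<longleftrightarrow> a = b"
    "lee_form g nabla \<phi> e (e 0) = - lee_form_star g nabla \<phi> e (e 0) \<longleftrightarrow> a = - b"
    "lee_form g nabla \<phi> e (e 0) = (\<lambda>_. sqrt 3) * lee_form_star g nabla \<phi> e (e 0)
      \<longleftrightarrow> a = sqrt 3 * b"
    "lee_form g nabla \<phi> e (e 0) = - ((\<lambda>_. sqrt 3) * lee_form_star g nabla \<phi> e (e 0))
      \<longleftrightarrow> a = - (sqrt 3 * b)"
    unfolding lee_form_e0 lee_form_star_e0 times_fun_def fun_Compl_def const_fun_eq by linarith+
  have phiB: "\<forall>i j. phiB_connection \<phi> (e 0) \<eta> nabla (e i) (e j) = 0"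
    by (intro allI phiB_connection_e)
  have canonical:
    "\<forall>D. phi_canonical_connection A \<phi> (e 0) \<eta> g D \<longrightarrow> (\<forall>i j. D (e i) (e j) = 0)"
  proof (rule allI, rule impI, rule allI, rule allI)
    fix D i j
    assume "phi_canonical_connection A \<phi> (e 0) \<eta> g D"
    then have "natural_connection A \<phi> (e 0) \<eta> g D"
      unfolding phi_canonical_connection_def by (rule conjunct1)
    then show "D (e i) (e j) = 0" using e_vf by (rule natural_connection_e)
  qed
  show ?thesis
    unfolding Let_def assms(13) isotropic scalar star theta class_F4_iff class_F5_iff
      class_F0_iff ricci_flat_iff star_ricci_flat_iff flat_iff
    by (simp only: phiB simp_thms) (rule canonical)
qed

end
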